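(* There exists a Fibonacci-automatic function $g_3:\mathbb{N}\to\{0,1,2\}$ such that, for all $n\ge 0$, the $n$-th non-terminal $\mathcal{P}$-position $(a_n,b_n)$ of $K^3$ is given by \[ a_n=\lfloor (n+2)\phi\rfloor+g_3(n+1)-1\quad\text{and}\quad b_n=\lfloor (n+2)\phi^2\rfloor+g_3(n+1)+1 . \]
   Context: $\phi=(1+\sqrt5)/2$. Positions are pairs $(x,y)\in\mathbb{N}^2$. A Wythoff move from $(x,y)$ leads to $(x-i,y)$ with $1\le i\le x$, to $(x,y-i)$ with $1\le i\le y$, or to $(x-i,y-i)$ with $1\le i\le\min(x,y)$. For $\ell\in\mathbb{N}$, $K^\ell$ is the two-player impartial game with Wythoff moves in which the positions of $\{(x,y): x+y\le\ell\}$ are terminal: no move is allowed from a terminal position, and a player who moves into a terminal position wins (normal play). A $\mathcal{P}$-position is a position from which the previous player has a winning strategy. The non-terminal $\mathcal{P}$-positions $(a,b)$ with $a<b$, listed in increasing order of $a$, are denoted $(a_n,b_n)$, $n\ge 0$ (so $(a_0,b_0)$ is the first one). The Fibonacci sequence is $F_0=1,F_1=2,F_{n+2}=F_{n+1}+F_n$, and $\mathrm{rep}_F(n)$ is the greedy representation of $n$ over $\{0,1\}$ (no two consecutive $1$'s, empty for $n=0$). A function $u:\mathbb{N}\to\Delta$ is Fibonacci-automatic if some deterministic finite automaton with output, fed with $\mathrm{rep}_F(n)$, outputs $u(n)$. *)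

theory Defs
  imports Complex_Main "HOL-Number_Theory.Fib"
begin

definition golden_ratio :: real where
  "golden_ratio = (1 + sqrt 5) / 2"


subsection \<open>The game\<close>

type_synonym position = "nat \<times> nat"

inductive wythoff_move :: "position \<Rightarrow> position \<Rightarrow> bool" where
  first: "1 \<le> i \<Longrightarrow> i \<le> x \<Longrightarrow> wythoff_move (x, y) (x - i, y)"
| second: "1 \<le> i \<Longrightarrow> i \<le> y \<Longrightarrow> wythoff_move (x, y) (x, y - i)"
| both: "1 \<le> i \<Longrightarrow> i \<le> min x y \<Longrightarrow> wythoff_move (x, y) (x - i, y - i)"

definition K_terminal :: "nat \<Rightarrow> position \<Rightarrow> bool" where
  "K_terminal l p \<longleftrightarrow> fst p + snd p \<le> l"

definition K_move :: "nat \<Rightarrow> position \<Rightarrow> position \<Rightarrow> bool" where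
  "K_move l p q \<longleftrightarrow> \<not> K_terminal l p \<and> wythoff_move p q"

text \<open>
  A finished play from \<open>p\<close> is the list of positions visited.  Every non-terminal position has
  a move and every move decreases the sum of the coordinates, so a play that is continued as
  long as possible always ends in a terminal position after finitely many moves.
\<close>

definition finished_play :: "nat \<Rightarrow> position \<Rightarrow> position list \<Rightarrow> bool" where
  "finished_play l p ps \<longleftrightarrow>
     ps \<noteq> [] \<and> hd ps = p \<and> successively (K_move l) ps \<and> K_terminal l (last ps)"

text \<open>
  Strategies are positional: a strategy picks a legal move in every non-terminal position (its
  values at terminal positions are irrelevant).  When play starts in \<open>p\<close>, the next player
  moves from the entries of the list of positions with even index and the previous player from
  those with odd index.  The player who made the last move wins; for a play without moves this
  is the previous player.  Hence the previous player wins iff the last entry has even index,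
  that is, iff the list has odd length.
\<close>

definition K_strategy :: "nat \<Rightarrow> (position \<Rightarrow> position) \<Rightarrow> bool" where
  "K_strategy l \<sigma> \<longleftrightarrow> (\<forall>p. \<not> K_terminal l p \<longrightarrow> K_move l p (\<sigma> p))"

definition previous_follows :: "(position \<Rightarrow> position) \<Rightarrow> position list \<Rightarrow> bool" where
  "previous_follows \<sigma> ps \<longleftrightarrow>
     (\<forall>i. odd i \<and> Suc i < length ps \<longrightarrow> ps ! Suc i = \<sigma> (ps ! i))"

definition P_position :: "nat \<Rightarrow> position \<Rightarrow> bool" where
  "P_position l p \<longleftrightarrow>
     (\<exists>\<sigma>. K_strategy l \<sigma> \<and>
        (\<forall>ps. finished_play l p ps \<and> previous_follows \<sigma> ps \<longrightarrow> odd (length ps)))"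

text \<open>
  Surjectivity together with strict monotonicity of \<open>a\<close> says that \<open>(a n, b n)\<close>,
  \<open>n \<ge> 0\<close>, is the complete list in increasing order of first coordinates; at most one
  pair of functions \<open>a\<close>, \<open>b\<close> has this property.
\<close>

definition nonterminal_P_listing :: "nat \<Rightarrow> (nat \<Rightarrow> nat) \<Rightarrow> (nat \<Rightarrow> nat) \<Rightarrow> bool" where
  "nonterminal_P_listing l a b \<longleftrightarrow>
     strict_mono a \<and>
     range (\<lambda>n. (a n, b n)) = {(x, y). x < y \<and> \<not> K_terminal l (x, y) \<and> P_position l (x, y)}"


subsection \<open>Fibonacci-automatic functions\<close>

text \<open>Indexed so that the sequence starts 1, 2, 3, 5.\<close>

definition fib_F :: "nat \<Rightarrow> nat" where
  "fib_F n = fib (n + 2)"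

text \<open>
  \<open>greedy_digits k n\<close> are the digits produced by the greedy algorithm for the weights
  \<open>fib_F (k - 1), \<dots>, fib_F 0\<close>, most significant digit first.
\<close>

fun greedy_digits :: "nat \<Rightarrow> nat \<Rightarrow> nat list" where
  "greedy_digits 0 n = []"
| "greedy_digits (Suc k) n =
     (if fib_F k \<le> n then 1 # greedy_digits k (n - fib_F k) else 0 # greedy_digits k n)"

text \<open>The first weight used is the largest one not exceeding \<open>n\<close>, so there are no leading zeros.\<close>

definition rep_F :: "nat \<Rightarrow> nat list" where
  "rep_F n = greedy_digits (LEAST k. n < fib_F k) n"

text \<open>
  A deterministic finite automaton with output has states \<open>Q\<close> (without loss of generality
  natural numbers), initial state \<open>q\<^sub>0\<close>, transition function \<open>\<delta>\<close> over the
  alphabet \<open>{0, 1}\<close>, and output function \<open>\<tau>\<close>.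
\<close>

definition fibonacci_automatic :: "(nat \<Rightarrow> 'd) \<Rightarrow> bool" where
  "fibonacci_automatic u \<longleftrightarrow>
     (\<exists>(Q :: nat set) q\<^sub>0 (\<delta> :: nat \<Rightarrow> nat \<Rightarrow> nat) (\<tau> :: nat \<Rightarrow> 'd).
        finite Q \<and> q\<^sub>0 \<in> Q \<and> (\<forall>q\<in>Q. \<forall>d\<in>{0, 1}. \<delta> q d \<in> Q) \<and>
        (\<forall>n. u n = \<tau> (foldl \<delta> q\<^sub>0 (rep_F n))))"

end

theory Submission
  imports Defs "HOL-Library.FuncSet"
begin

text \<open>
  With \<open>n = m - 1\<close>, the pairs \<open>(low m, high m)\<close>, \<open>m \<ge> 1\<close>, are determined by
  \<open>high m = low m + m + 3\<close> and the requirement that all their entries together are the numbers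
  from \<open>4\<close> on, each occurring once.  Hence \<open>low (low m) = low m + m + 2\<close>, and the consecutive
  differences of \<open>low\<close> are \<open>2\<close> at the values of \<open>low\<close> and \<open>1\<close> elsewhere.

  Passing from \<open>m\<close> to \<open>low m\<close> multiplies the deviation \<open>low m - (m + 1) \<phi>\<close> by \<open>1 - \<phi>\<close>, up to
  a constant, so the deviation is bounded.  This gives \<open>low m = shift m + gap m\<close> with
  \<open>gap m \<in> {0, 1, 2}\<close>, where \<open>shift m = \<lfloor>(m + 1) \<phi>\<rfloor> - 1\<close> appends the digit \<open>0\<close> to the
  Fibonacci representation of \<open>m\<close>.

  Appending a digit \<open>d\<close> replaces \<open>m\<close> by \<open>shift m + d = low m - (gap m - d)\<close>.  Around \<open>low m\<close>
  the values of \<open>low\<close> are determined by those around \<open>m\<close>, and because \<open>low\<close> is expanding, a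
  window of five positions at \<open>m\<close> suffices to recover the same window at \<open>shift m + d\<close>.  So
  \<open>gap m\<close> and this window are the state of a finite automaton, which never needs to be computed.
\<close>

section \<open>The sequences of coordinates\<close>

text \<open>The value at \<open>0\<close> does not belong to a P-position.\<close>

fun low :: "nat \<Rightarrow> nat" where
  "low 0 = 3"
| "low (Suc j) = low j + (if \<exists>i\<in>{1..j}. low i = j then 2 else 1)"

definition high :: "nat \<Rightarrow> nat" where
  "high m = low m + m + 3"

definition is_low :: "nat \<Rightarrow> bool" where
  "is_low k \<longleftrightarrow> (\<exists>i\<ge>1. low i = k)"

declare low.simps(2) [simp del]

lemma low_less_Suc: "low j < low (Suc j)"
  by (simp add: low.simps)

lemma strict_mono_low: "strict_mono low"
  by (simp add: strict_mono_Suc_iff low_less_Suc)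

lemma low_less_iff [simp]: "low i < low j \<longleftrightarrow> i < j"
  by (simp add: strict_mono_less strict_mono_low)

lemma low_le_iff [simp]: "low i \<le> low j \<longleftrightarrow> i \<le> j"
  by (simp add: strict_mono_less_eq strict_mono_low)

lemma low_eq_iff [simp]: "low i = low j \<longleftrightarrow> i = j"
  by (simp add: strict_mono_eq strict_mono_low)

lemma low_ge: "k + 3 \<le> low k"
proof (induction k)
  case (Suc k)
  then show ?case using low_less_Suc[of k] by linarith
qed simp

text \<open>The range \<open>{1..j}\<close> in the recursion makes it terminate;
  \<open>low i \<ge> i + 3\<close> confines every preimage of \<open>j\<close> to it.\<close>

lemma low_Suc: "low (Suc j) = low j + (if is_low j then 2 else 1)"
proof -
  have "(\<exists>i\<in>{1..j}. low i = j) \<longleftrightarrow> is_low j"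
  proof
    assume "is_low j"
    then obtain i where "i \<ge> 1" "low i = j" unfolding is_low_def by blast
    moreover from this have "i \<le> j" using low_ge[of i] by linarith
    ultimately show "\<exists>i\<in>{1..j}. low i = j" by auto
  qed (auto simp: is_low_def)
  then show ?thesis by (simp add: low.simps)
qed

lemma is_low_low: "m \<ge> 1 \<Longrightarrow> is_low (low m)"
  by (auto simp: is_low_def)

lemma is_low_ge: "is_low k \<Longrightarrow> k \<ge> 4"
proof -
  assume "is_low k"
  then obtain i where "i \<ge> 1" "low i = k" unfolding is_low_def by blast
  then show ?thesis using low_ge[of i] by linarith
qed

lemma low_1: "low 1 = 4"
proof -
  have "\<not> is_low 0" using is_low_ge by fastforce
  then show ?thesis using low_Suc[of 0] by simp
qed

lemma low_le_4: "m \<le> 4 \<Longrightarrow> low m = m + 3"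
proof (induction m)
  case (Suc m)
  then have "\<not> is_low m" using is_low_ge by fastforce
  then show ?case using Suc low_Suc[of m] by simp
qed simp

lemma is_low_Suc_low: "is_low (Suc (low m)) \<longleftrightarrow> \<not> is_low m"
proof
  assume "is_low (Suc (low m))"
  then obtain i where i: "low i = Suc (low m)" unfolding is_low_def by blast
  then have "m < i" using low_less_iff[of m i] by linarith
  then have "low (Suc m) \<le> low i" by simp
  then show "\<not> is_low m" using i low_Suc[of m] by (auto split: if_splits)
next
  assume "\<not> is_low m"
  then have "low (Suc m) = Suc (low m)" using low_Suc[of m] by simp
  then show "is_low (Suc (low m))" unfolding is_low_def
    by (metis One_nat_def Suc_le_mono zero_le)
qed

text \<open>From \<open>m\<close> to \<open>Suc m\<close> both sides rise equally: the step at
  \<open>low m\<close> contributes 2, and if \<open>is_low m\<close>, a further step at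
  \<open>Suc (low m)\<close>, which is not a value, contributes 1.\<close>

lemma low_low:
  assumes "m \<ge> 1"
  shows "low (low m) = low m + m + 2"
  using assms
proof (induction m rule: nat_induct_at_least)
  case base
  then show ?case using low_le_4[of 4] low_1 by simp
next
  case (Suc m)
  have 1: "low (Suc (low m)) = low (low m) + 2"
    using low_Suc[of "low m"] is_low_low[of m] Suc by simp
  show ?case
  proof (cases "is_low m")
    case True
    then have "low (Suc m) = Suc (Suc (low m))" using low_Suc[of m] by simp
    moreover have "low (Suc (Suc (low m))) = low (Suc (low m)) + 1"
      using low_Suc[of "Suc (low m)"] is_low_Suc_low[of m] True by simp
    ultimately show ?thesis using 1 Suc by simp
  next
    case False
    then have "low (Suc m) = Suc (low m)" using low_Suc[of m] by simp
    then show ?thesis using 1 Suc by simp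
  qed
qed

lemma high_eq_Suc_low_low: "m \<ge> 1 \<Longrightarrow> high m = Suc (low (low m))"
  by (simp add: high_def low_low)

lemma not_is_low_high: "m \<ge> 1 \<Longrightarrow> \<not> is_low (high m)"
  using high_eq_Suc_low_low is_low_Suc_low is_low_low by simp

text \<open>A missed \<open>k\<close> lies inside a jump by 2, so \<open>k = Suc (low j)\<close>
  with \<open>is_low j\<close>; writing \<open>j = low m\<close> yields
  \<open>high m\<close>.\<close>

lemma is_high_if_not_is_low:
  assumes "k \<ge> 4" "\<not> is_low k"
  shows "\<exists>m\<ge>1. k = high m"
proof -
  have "3 \<le> k" using assms(1) by simp
  then have "\<exists>j. low j \<le> k \<and> k < low (Suc j)"
  proof (induction k rule: nat_induct_at_least)
    case base
    then show ?case by (intro exI[of _ 0]) (simp add: low_1[simplified])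
  next
    case (Suc k)
    then obtain j where j: "low j \<le> k" "k < low (Suc j)" by blast
    show ?case
    proof (cases "Suc k < low (Suc j)")
      case True
      then show ?thesis using j by (intro exI[of _ j]) simp
    next
      case False
      then have "Suc k = low (Suc j)" using j by simp
      then show ?thesis using low_less_Suc[of "Suc j"] by (intro exI[of _ "Suc j"]) simp
    qed
  qed
  then obtain j where j: "low j \<le> k" "k < low (Suc j)"  by blast
  have "j \<ge> 1"
  proof (rule ccontr)
    assume "\<not> 1 \<le> j"
    then have "j = 0" by simp
    then show False using j assms low_1 by simp
  qed
  then have "k \<noteq> low j" using assms(2) is_low_low by blast
  then have k: "is_low j" "k = Suc (low j)" using j low_Suc[of j] by (auto split: if_splits)
  then obtain m where "m \<ge> 1" "low m = j" unfolding is_low_def by blast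
  then show ?thesis using k high_eq_Suc_low_low[of m] by (intro exI[of _ m]) simp
qed

lemma is_low_Suc_if_not_is_low:
  assumes "k \<ge> 4" "\<not> is_low k"
  shows "is_low (Suc k)"
proof -
  obtain m where m: "m \<ge> 1" "k = high m" using is_high_if_not_is_low[OF assms] by blast
  then have "low (Suc (low m)) = Suc k"
    using low_Suc[of "low m"] is_low_low[of m] high_eq_Suc_low_low by simp
  then show ?thesis unfolding is_low_def by (metis One_nat_def Suc_le_mono zero_le)
qed


section \<open>The P-positions\<close>

lemma K_move_sum_less: "K_move l p q \<Longrightarrow> fst q + snd q < fst p + snd p"
  unfolding K_move_def by (auto elim!: wythoff_move.cases)

lemma ex_K_move: "\<not> K_terminal l p \<Longrightarrow> \<exists>q. K_move l p q"
proof -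
  assume nt: "\<not> K_terminal l p"
  obtain x y where p: "p = (x, y)" by force
  have "x \<ge> 1 \<or> y \<ge> 1" using nt by (auto simp: K_terminal_def p)
  then have "\<exists>q. wythoff_move (x, y) q"
    using wythoff_move.first[of 1 x y] wythoff_move.second[of 1 y x] by auto
  then show ?thesis using nt by (auto simp: K_move_def p)
qed

text \<open>A kernel of the game graph. As moves lower the coordinate sum, it can only be the set of
  P-positions, which separates strategies from the arithmetic of \<open>low\<close>.\<close>

locale kernel =
  fixes l :: nat and S :: "position set"
  assumes terminal: "K_terminal l p \<Longrightarrow> p \<in> S"
    and stable: "p \<in> S \<Longrightarrow> K_move l p q \<Longrightarrow> q \<notin> S"
    and absorbing: "p \<notin> S \<Longrightarrow> \<exists>q\<in>S. K_move l p q"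
begin

text \<open>The previous player always moves back into \<open>S\<close>. The play is then in
  \<open>S\<close> exactly at even indices, and its terminal end is in \<open>S\<close>.\<close>

lemma P_position_if_mem:
  assumes "p \<in> S"
  shows "P_position l p"
proof -
  have "\<exists>\<sigma>. \<forall>p. (\<not> K_terminal l p \<longrightarrow> K_move l p (\<sigma> p)) \<and> (p \<notin> S \<longrightarrow> \<sigma> p \<in> S)"
  proof (rule choice, rule allI)
    fix p
    show "\<exists>q. (\<not> K_terminal l p \<longrightarrow> K_move l p q) \<and> (p \<notin> S \<longrightarrow> q \<in> S)"
      using absorbing[of p] ex_K_move[of l p] by (cases "p \<in> S") auto
  qed
  then obtain \<sigma> where \<sigma>: "\<And>p. \<not> K_terminal l p \<Longrightarrow> K_move l p (\<sigma> p)" "\<And>p. p \<notin> S \<Longrightarrow> \<sigma> p \<in> S"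
    by blast
  have "odd (length ps)" if fin: "finished_play l p ps" and fol: "previous_follows \<sigma> ps" for ps
  proof -
    have ne: "ps \<noteq> []" and hd: "ps ! 0 = p" and last: "K_terminal l (last ps)"
      and suc: "\<And>i. Suc i < length ps \<Longrightarrow> K_move l (ps ! i) (ps ! Suc i)"
      using fin unfolding finished_play_def successively_conv_nth by (auto simp: hd_conv_nth)
    have par: "i < length ps \<Longrightarrow> (ps ! i \<in> S \<longleftrightarrow> even i)" for i
    proof (induction i)
      case 0
      then show ?case using assms hd by simp
    next
      case (Suc i)
      show ?case
      proof (cases "even i")
        case True
        then show ?thesis using Suc suc[of i] stable by auto
      next
        case False
        then have "ps ! Suc i = \<sigma> (ps ! i)" using fol Suc.prems unfolding previous_follows_def by blast
        then show ?thesis using False Suc \<sigma>(2) by auto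
      qed
    qed
    have "last ps = ps ! (length ps - 1)" using ne by (simp add: last_conv_nth)
    then have "even (length ps - 1)" using par[of "length ps - 1"] ne last terminal by simp
    then show ?thesis using ne by (cases ps) auto
  qed
  then show ?thesis unfolding P_position_def K_strategy_def using \<sigma>(1) by blast
qed

text \<open>Against any \<open>\<sigma>\<close> the next player keeps moving into \<open>S\<close>,
  which \<open>\<sigma>\<close> must leave again, until a terminal position is reached.\<close>

lemma ex_even_play:
  assumes strat: "K_strategy l \<sigma>" and "p \<notin> S"
  shows "\<exists>ps. finished_play l p ps \<and> previous_follows \<sigma> ps \<and> even (length ps)"
  using assms(2)
proof (induction "fst p + snd p" arbitrary: p rule: less_induct)
  case less
  obtain q where q: "q \<in> S" "K_move l p q" using absorbing less.prems by blast
  show ?case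
  proof (cases "K_terminal l q")
    case True
    then show ?thesis using q
      by (intro exI[of _ "[p, q]"]) (auto simp: finished_play_def previous_follows_def)
  next
    case False
    then have mv: "K_move l q (\<sigma> q)" using strat unfolding K_strategy_def by blast
    then have "\<sigma> q \<notin> S" using stable q by blast
    moreover have "fst (\<sigma> q) + snd (\<sigma> q) < fst p + snd p"
      using K_move_sum_less[OF mv] K_move_sum_less[OF q(2)] by simp
    ultimately obtain ps where ps: "finished_play l (\<sigma> q) ps" "previous_follows \<sigma> ps" "even (length ps)"
      using less.hyps by blast
    have "finished_play l p (p # q # ps)"
      using ps(1) q mv by (cases ps) (auto simp: finished_play_def)
    moreover have "previous_follows \<sigma> (p # q # ps)"
      unfolding previous_follows_def
    proof (intro allI impI)
      fix i assume i: "odd i \<and> Suc i < length (p # q # ps)"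
      show "(p # q # ps) ! Suc i = \<sigma> ((p # q # ps) ! i)"
      proof (cases "i = 1")
        case True
        have "ps ! 0 = \<sigma> q" using ps(1) by (auto simp: finished_play_def hd_conv_nth)
        then show ?thesis using True by simp
      next
        case False
        then obtain j where j: "i = Suc (Suc j)" using i
          by (metis One_nat_def even_zero not0_implies_Suc)
        then show ?thesis using i ps(2) by (simp add: previous_follows_def)
      qed
    qed
    ultimately show ?thesis using ps(3) by (intro exI[of _ "p # q # ps"]) simp
  qed
qed

lemma P_position_iff: "P_position l p \<longleftrightarrow> p \<in> S"
  using P_position_if_mem ex_even_play unfolding P_position_def by blast

end

section \<open>The kernel of K^3\<close>

definition K3_kernel :: "position set" where
  "K3_kernel = {p. K_terminal 3 p} \<union> {(low m, high m) |m. m \<ge> 1} \<union> {(high m, low m) |m. m \<ge> 1}"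

lemma high_eq_iff: "high i = high j \<longleftrightarrow> i = j"
proof -
  have "strict_mono high" unfolding strict_mono_Suc_iff high_def
    by (simp add: less_Suc_eq_le less_imp_le[OF low_less_Suc] less_SucI)
  then show ?thesis by (rule strict_mono_eq)
qed

lemma low_neq_high: "i \<ge> 1 \<Longrightarrow> j \<ge> 1 \<Longrightarrow> low i \<noteq> high j"
  using is_low_low not_is_low_high by metis

lemma K3_kernel_swap: "(x, y) \<in> K3_kernel \<longleftrightarrow> (y, x) \<in> K3_kernel"
  by (auto simp: K3_kernel_def K_terminal_def)

lemma wythoff_move_swap: "wythoff_move (x, y) (x', y') \<Longrightarrow> wythoff_move (y, x) (y', x')"
  by (auto elim!: wythoff_move.cases intro!: wythoff_move.intros)

lemma K_move_swap: "K_move l (x, y) (x', y') \<Longrightarrow> K_move l (y, x) (y', x')"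
  by (auto simp: K_move_def K_terminal_def wythoff_move_swap)

text \<open>A move along a row or column keeps a coordinate, which occurs in one pair only; a
  diagonal move keeps the difference \<open>m + 3\<close>, which determines \<open>m\<close> and
  exceeds 3.\<close>

lemma K3_kernel_stable_low_high:
  assumes m: "m \<ge> 1" and mv: "wythoff_move (low m, high m) q"
  shows "q \<notin> K3_kernel"
proof
  assume "q \<in> K3_kernel"
  moreover obtain x y where q: "q = (x, y)" by force
  ultimately consider (t) "x + y \<le> 3" | (lh) k where "k \<ge> 1" "x = low k" "y = high k"
    | (hl) k where "k \<ge> 1" "x = high k" "y = low k"
    by (auto simp: K3_kernel_def K_terminal_def)
  note target = this
  have lm: "low m \<ge> 4" using low_ge[of m] m by simp
  have lk: "low k < high k" for k by (simp add: high_def)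
  show False using mv[unfolded q]
  proof (cases rule: wythoff_move.cases)
    case (first i)
    show False using target
    proof cases
      case t then show ?thesis using first m by (simp add: high_def)
    next
      case (lh k) then show ?thesis using first by (simp add: high_eq_iff)
    next
      case (hl k) then show ?thesis using first low_neq_high[of k m] m by simp
    qed
  next
    case (second i)
    show False using target
    proof cases
      case t then show ?thesis using second lm by simp
    next
      case (lh k) then show ?thesis using second by simp
    next
      case (hl k) then show ?thesis using second low_neq_high[of m k] m by simp
    qed
  next
    case (both i)
    then have d: "y = x + m + 3" by (auto simp: high_def)
    show False using target
    proof cases
      case t then show ?thesis using d m by simp
    next
      case (lh k)
      then have "k = m" using d by (simp add: high_def)
      then show ?thesis using both lh lm by simp
    next
      case (hl k)
      then show ?thesis using d lk[of k] by simp
    qed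
  qed
qed

lemma K3_kernel_absorbing_le:
  assumes "x \<le> y" "(x, y) \<notin> K3_kernel"
  shows "\<exists>q\<in>K3_kernel. K_move 3 (x, y) q"
proof -
  have nt: "x + y \<ge> 4" using assms(2) by (auto simp: K3_kernel_def K_terminal_def)
  have "\<exists>q\<in>K3_kernel. wythoff_move (x, y) q"
  proof (cases "x \<ge> 4")
    case False
    then have "(x, 0) \<in> K3_kernel" by (simp add: K3_kernel_def K_terminal_def)
    moreover have "wythoff_move (x, y) (x, 0)"
      using wythoff_move.second[of y y x] False nt assms(1) by simp
    ultimately show ?thesis by blast
  next
    case x4: True
    show ?thesis
    proof (cases "is_low x")
      case False
      then obtain m where m: "m \<ge> 1" "x = high m" using is_high_if_not_is_low x4 by blast
      have "low m < y" using m assms(1) by (simp add: high_def)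
      then have "wythoff_move (x, y) (x, low m)"
        using wythoff_move.second[of "y - low m" y x] by simp
      moreover have "(x, low m) \<in> K3_kernel" using m by (auto simp: K3_kernel_def)
      ultimately show ?thesis by blast
    next
      case True
      then obtain m where m: "m \<ge> 1" "x = low m" unfolding is_low_def by blast
      have "y \<noteq> high m" using assms(2) m by (auto simp: K3_kernel_def)
      then consider (gt) "y > high m" | (lt) "y < high m" by linarith
      then show ?thesis
      proof cases
        case gt
        then have "wythoff_move (x, y) (x, high m)"
          using wythoff_move.second[of "y - high m" y x] by simp
        moreover have "(x, high m) \<in> K3_kernel" using m by (auto simp: K3_kernel_def)
        ultimately show ?thesis by blast
      next
        case lt
        show ?thesis
        proof (cases "y - x \<le> 3")
          case True
          then have "(0, y - x) \<in> K3_kernel" by (simp add: K3_kernel_def K_terminal_def)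
          moreover have "wythoff_move (x, y) (0, y - x)"
            using wythoff_move.both[of x x y] x4 assms(1) by simp
          ultimately show ?thesis by blast
        next
          case False
          \<comment> \<open>\<open>k\<close> is the index of the pair on the same diagonal;
            \<open>y < high m\<close> forces \<open>k < m\<close>, so that pair lies below.\<close>
          define k where "k = y - x - 3"
          have k: "k \<ge> 1" "y = x + k + 3" "k < m"
            using False lt m by (auto simp: k_def high_def)
          then have "low k < x" using m by simp
          moreover have "x - (x - low k) = low k" "y - (x - low k) = high k"
            using \<open>low k < x\<close> k by (auto simp: high_def)
          ultimately have "wythoff_move (x, y) (low k, high k)"
            using wythoff_move.both[of "x - low k" x y] k by simp
          moreover have "(low k, high k) \<in> K3_kernel" using k by (auto simp: K3_kernel_def)
          ultimately show ?thesis by blast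
        qed
      qed
    qed
  qed
  then show ?thesis using nt by (auto simp: K_move_def K_terminal_def)
qed

interpretation K3: kernel 3 K3_kernel
proof
  show "p \<in> K3_kernel" if "K_terminal 3 p" for p
    using that by (simp add: K3_kernel_def)
next
  fix p q assume p: "p \<in> K3_kernel" and mv: "K_move 3 p q"
  then consider (lh) m where "m \<ge> 1" "p = (low m, high m)" | (hl) m where "m \<ge> 1" "p = (high m, low m)"
    by (auto simp: K3_kernel_def K_move_def)
  then show "q \<notin> K3_kernel"
  proof cases
    case lh
    then show ?thesis using K3_kernel_stable_low_high mv by (auto simp: K_move_def)
  next
    case hl
    moreover obtain x y where "q = (x, y)" by force
    ultimately show ?thesis
      using K3_kernel_stable_low_high[of m "(y, x)"] K3_kernel_swap[of x y] mv wythoff_move_swap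
      by (auto simp: K_move_def)
  qed
next
  fix p assume p: "p \<notin> K3_kernel"
  obtain x y where xy: "p = (x, y)" by force
  show "\<exists>q\<in>K3_kernel. K_move 3 p q"
  proof (cases "x \<le> y")
    case True
    then show ?thesis using K3_kernel_absorbing_le p xy by simp
  next
    case False
    then obtain x' y' where "(x', y') \<in> K3_kernel" "K_move 3 (y, x) (x', y')"
      using K3_kernel_absorbing_le[of y x] K3_kernel_swap[of x y] p xy by auto
    then show ?thesis using K_move_swap K3_kernel_swap xy by blast
  qed
qed

lemma nonterminal_P_listing_low_high:
  "nonterminal_P_listing 3 (\<lambda>n. low (n + 1)) (\<lambda>n. high (n + 1))"
  unfolding nonterminal_P_listing_def
proof
  show "strict_mono (\<lambda>n. low (n + 1))" by (simp add: strict_mono_def)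
  have "(\<exists>n. x = low (n + 1) \<and> y = high (n + 1)) \<longleftrightarrow> x < y \<and> \<not> K_terminal 3 (x, y) \<and> (x, y) \<in> K3_kernel"
    (is "?L \<longleftrightarrow> ?R") for x y
  proof
    assume ?L
    then obtain n where "x = low (n + 1)" "y = high (n + 1)" by blast
    then show ?R using low_ge[of "n + 1"] unfolding K3_kernel_def K_terminal_def
      by (auto simp: high_def intro!: exI[of _ "Suc n"])
  next
    assume ?R
    then obtain m where "m \<ge> 1" "x = low m" "y = high m"
      by (auto simp: K3_kernel_def high_def)
    then show ?L by (intro exI[of _ "m - 1"]) simp
  qed
  then show "range (\<lambda>n. (low (n + 1), high (n + 1))) =
      {(x, y). x < y \<and> \<not> K_terminal 3 (x, y) \<and> P_position 3 (x, y)}"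
    unfolding K3.P_position_iff by (auto simp: image_iff)
qed


section \<open>The Fibonacci shift\<close>

definition shift :: "nat \<Rightarrow> nat" where
  "shift m = nat (\<lfloor>real (m + 1) * golden_ratio\<rfloor> - 1)"

lemma golden_ratio_bounds: "8 / 5 < golden_ratio" "golden_ratio < 81 / 50"
proof -
  have "sqrt 5 > 11 / 5" by (rule real_less_rsqrt) (simp add: power2_eq_square)
  then show "8 / 5 < golden_ratio" by (simp add: golden_ratio_def)
  have "sqrt 5 < 56 / 25" by (rule real_less_lsqrt) (simp_all add: power2_eq_square)
  then show "golden_ratio < 81 / 50" by (simp add: golden_ratio_def)
qed

lemma golden_ratio_square: "golden_ratio * golden_ratio = golden_ratio + 1"
  by (simp add: golden_ratio_def field_simps)

lemma shift_eqI:
  assumes "real y + 1 \<le> real (m + 1) * golden_ratio" "real (m + 1) * golden_ratio < real y + 2"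
  shows "shift m = y"
proof -
  have "\<lfloor>real (m + 1) * golden_ratio\<rfloor> = int y + 1"
    using assms by (intro floor_unique) auto
  then show ?thesis by (simp add: shift_def)
qed

lemma floor_eq_shift: "\<lfloor>real (m + 1) * golden_ratio\<rfloor> = int (shift m) + 1"
proof -
  have "1 * 1 \<le> real (m + 1) * golden_ratio"
    using golden_ratio_bounds by (intro mult_mono) auto
  then have "\<lfloor>real (m + 1) * golden_ratio\<rfloor> \<ge> 1" by (simp add: le_floor_iff)
  then show ?thesis by (simp add: shift_def)
qed

lemma shift_bounds:
  "real (shift m) + 1 \<le> real (m + 1) * golden_ratio" "real (m + 1) * golden_ratio < real (shift m) + 2"
  using floor_eq_shift[of m] by linarith+

lemma shift_ge: "shift m \<ge> m"
proof -
  have "real (m + 1) * (8 / 5) \<le> real (m + 1) * golden_ratio"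
    using golden_ratio_bounds by (intro mult_left_mono) simp_all
  then have "real m < real (shift m) + 1" using shift_bounds[of m] by simp
  then show ?thesis by linarith
qed

text \<open>
  An index \<open>k \<ge> 4\<close> is \<open>low j\<close> or \<open>low j + 1\<close>, and its deviation is then
  \<open>1 - \<phi> - (\<phi> - 1) e\<close> or \<open>3 - 2 \<phi> - (\<phi> - 1) e\<close>, where \<open>e\<close> is that of \<open>j\<close>.
\<close>

lemma low_deviation:
  assumes "m \<ge> 1"
  shows "- 3 / 2 \<le> low m - real (m + 1) * golden_ratio \<and> low m - real (m + 1) * golden_ratio \<le> 1"
  using assms
proof (induction m rule: less_induct)
  case (less k)
  note b = golden_ratio_bounds
  \<comment> \<open>The two deviation maps differ by \<open>2 - \<phi> > 0\<close>, so a lower bound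
    for the smaller and an upper bound for the larger serve both.\<close>
  have step: "- 3 / 2 \<le> 1 - golden_ratio - (golden_ratio - 1) * e"
      "3 - 2 * golden_ratio - (golden_ratio - 1) * e \<le> 1"
    if "- 3 / 2 \<le> e \<and> e \<le> 1" for e :: real
  proof -
    have "(golden_ratio - 1) * (- 3 / 2) \<le> (golden_ratio - 1) * e"
      using that b by (intro mult_left_mono) simp_all
    moreover have "(golden_ratio - 1) * e \<le> (golden_ratio - 1) * 1"
      using that b by (intro mult_left_mono) simp_all
    ultimately show "- 3 / 2 \<le> 1 - golden_ratio - (golden_ratio - 1) * e"
      "3 - 2 * golden_ratio - (golden_ratio - 1) * e \<le> 1"
      using b by (simp_all add: algebra_simps diff_divide_distrib)
  qed
  have ident: "low (low m) - real (low m + 1) * golden_ratio =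
      1 - golden_ratio - (golden_ratio - 1) * (low m - real (m + 1) * golden_ratio)"
    if "m \<ge> 1" for m
  proof -
    have "(real m + 1) * (golden_ratio * golden_ratio) = (real m + 1) * (golden_ratio + 1)"
      by (simp only: golden_ratio_square)
    then show ?thesis by (simp add: low_low[OF that] algebra_simps)
  qed
  consider (small) "k \<le> 3" | (low) "k \<ge> 4" "is_low k" | (high) "k \<ge> 4" "\<not> is_low k" by linarith
  then show ?case
  proof cases
    case small
    then have "k = 1 \<or> k = 2 \<or> k = 3" using less.prems by linarith
    then show ?thesis using b low_le_4[of k] by (elim disjE) auto
  next
    case low
    then obtain m where m: "m \<ge> 1" "k = low m" unfolding is_low_def by blast
    then have "m < k" using low_ge[of m] by linarith
    then show ?thesis
      using less.IH[of m] m ident[of m] step[of "low m - real (m + 1) * golden_ratio"] b by simp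
  next
    case high
    then obtain m where m: "m \<ge> 1" "k = high m" using is_high_if_not_is_low by blast
    define j where "j = low m"
    have j: "j \<ge> 1" "is_low j" using low_ge[of m] m is_low_low by (auto simp: j_def)
    have k: "k = Suc (low j)" using m by (simp add: j_def high_eq_Suc_low_low)
    have "j < k" using k low_ge[of j] by linarith
    have "low k = low (low j) + 2" using low_Suc[of "low j"] is_low_low[of j] j k by simp
    then have "low k - real (k + 1) * golden_ratio =
        low (low j) - real (low j + 1) * golden_ratio + 2 - golden_ratio"
      by (simp add: k algebra_simps)
    then show ?thesis
      using less.IH[of j] j \<open>j < k\<close> ident[of j] step[of "low j - real (j + 1) * golden_ratio"] b
      by linarith
  qed
qed

text \<open>Rounding down costs less than 1, so for \<open>m \<ge> 1\<close> the deviation interval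
  puts \<open>low m - shift m\<close> into \<open>[- 1 / 2, 3)\<close>. This is the lower
  end.\<close>

lemma shift_le_low: "shift m \<le> low m"
proof (cases "m \<ge> 1")
  case True
  have "real (shift m) < real (low m) + 1"
    using low_deviation[OF True] shift_bounds[of m] by linarith
  then show ?thesis by linarith
next
  case False
  then have "m = 0" by simp
  then show ?thesis using shift_eqI[of 0 0] golden_ratio_bounds by simp
qed

lemma low_le_shift:
  assumes "m \<ge> 1"
  shows "low m \<le> shift m + 2"
proof -
  have "real (low m) < real (shift m) + 3"
    using low_deviation[OF assms] shift_bounds[of m] by linarith
  then show ?thesis by linarith
qed


section \<open>Fibonacci representations\<close>

text \<open>
  Reading digits \<open>d\<^sub>k, \<dots>, d\<^sub>0\<close> keeps track of \<open>x = \<Sum>i. d\<^sub>i F\<^sub>i\<close> and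
  \<open>y = \<Sum>i. d\<^sub>i F\<^bsub>i + 1\<^esub>\<close>; one more digit turns \<open>(x, y)\<close> into
  \<open>(y + d F\<^sub>0, x + y + d F\<^sub>1)\<close>.
\<close>

definition push_digit :: "nat \<times> nat \<Rightarrow> nat \<Rightarrow> nat \<times> nat" where
  "push_digit p d = (snd p + d, fst p + snd p + 2 * d)"

lemma push_digit_Pair [simp]: "push_digit (x, y) d = (y + d, x + y + 2 * d)"
  by (simp add: push_digit_def)

abbreviation read_digits :: "nat list \<Rightarrow> nat \<times> nat" where
  "read_digits \<equiv> foldl push_digit (0, 0)"

definition sparse_digits :: "nat list \<Rightarrow> bool" where
  "sparse_digits ds \<longleftrightarrow> set ds \<subseteq> {0, 1} \<and> successively (\<lambda>x y. x = 0 \<or> y = 0) ds"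

lemma fib_F_simps [simp]: "fib_F 0 = 1" "fib_F (Suc 0) = 2" "fib_F (Suc (Suc k)) = fib_F (Suc k) + fib_F k"
  by (simp_all add: fib_F_def numeral_2_eq_2)

lemma fib_F_mono_Suc: "fib_F k \<le> fib_F (Suc k)"
  by (cases k) simp_all

lemma fib_F_Suc_le: "fib_F (Suc k) \<le> 2 * fib_F k"
  using fib_F_mono_Suc by (cases k) simp_all

lemma less_fib_F: "k < fib_F k"
proof (induction k rule: induct_nat_012)
  case (ge2 n)
  then show ?case by simp
qed simp_all

lemma length_greedy_digits [simp]: "length (greedy_digits k n) = k"
  by (induction k n rule: greedy_digits.induct) simp_all

text \<open>\<open>push_digit\<close> is additive, and digit 0 advances a pair of consecutive
  Fibonacci numbers by one index. With \<open>j = 0\<close> this splits off a leading digit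
  1.\<close>

lemma foldl_push_digit_add:
  "foldl push_digit (x + fib_F j, y + fib_F (Suc j)) ds =
    (fst (foldl push_digit (x, y) ds) + fib_F (j + length ds),
     snd (foldl push_digit (x, y) ds) + fib_F (Suc (j + length ds)))"
proof (induction ds arbitrary: x y j)
  case (Cons d ds)
  have "push_digit (x + fib_F j, y + fib_F (Suc j)) d =
      ((y + d) + fib_F (Suc j), (x + y + 2 * d) + fib_F (Suc (Suc j)))"
    by simp
  then show ?case unfolding foldl_Cons push_digit_Pair[of x y] by (simp only: Cons.IH) simp
qed simp

lemma fst_read_greedy_digits: "n < fib_F k \<Longrightarrow> fst (read_digits (greedy_digits k n)) = n"
proof (induction k arbitrary: n)
  case (Suc k)
  show ?case
  proof (cases "fib_F k \<le> n")
    case True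
    then have "n - fib_F k < fib_F k" using Suc.prems fib_F_Suc_le[of k] by linarith
    then show ?thesis
      using True Suc.IH foldl_push_digit_add[of 0 0 0 "greedy_digits k (n - fib_F k)"]
by (simp add: numeral_2_eq_2)
  next
    case False
    then show ?thesis using Suc by simp
  qed
qed simp

lemma sparse_greedy_digits: "n < fib_F k \<Longrightarrow> sparse_digits (greedy_digits k n)"
proof (induction k arbitrary: n)
  case (Suc k)
  show ?case
  proof (cases "fib_F k \<le> n")
    case True
    then have "n - fib_F k < fib_F k" using Suc.prems fib_F_Suc_le[of k] by linarith
    \<comment> \<open>After \<open>fib_F k\<close> is taken from \<open>n < fib_F (Suc k)\<close>,
      less than \<open>fib_F (k - 1)\<close> remains, so the next digit is 0.\<close>
    moreover have "greedy_digits k (n - fib_F k) = [] \<or> hd (greedy_digits k (n - fib_F k)) = 0"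
      using Suc.prems True by (cases k) (simp_all add: less_diff_conv2 not_le)
    ultimately show ?thesis using True Suc.IH[of "n - fib_F k"]
      by (auto simp: sparse_digits_def successively_Cons)
  next
    case False
    then show ?thesis using Suc by (auto simp: sparse_digits_def successively_Cons)
  qed
qed (simp add: sparse_digits_def)

lemma less_fib_F_LEAST: "n < fib_F (LEAST k. n < fib_F k)"
  by (rule LeastI[of _ n]) (rule less_fib_F)

lemma fst_read_rep_F: "fst (read_digits (rep_F n)) = n"
  unfolding rep_F_def by (rule fst_read_greedy_digits) (rule less_fib_F_LEAST)

lemma sparse_rep_F: "sparse_digits (rep_F n)"
  unfolding rep_F_def by (rule sparse_greedy_digits) (rule less_fib_F_LEAST)

lemma sparse_digits_snoc:
  "sparse_digits (ds @ [d]) \<longleftrightarrow>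
    sparse_digits ds \<and> (d = 0 \<or> d = 1 \<and> (ds = [] \<or> last ds = 0))"
  by (auto simp: sparse_digits_def successively_append_iff)

text \<open>
  A digit \<open>d\<close> turns the error \<open>e = x \<phi> - y\<close> into \<open>- (\<phi> - 1) e - (2 - \<phi>) d\<close>.
\<close>

lemma read_digits_error:
  assumes "sparse_digits ds" "read_digits ds = (x, y)"
  shows "1 - golden_ratio < x * golden_ratio - y" "x * golden_ratio - y < 2 - golden_ratio"
    "ds = [] \<or> last ds = 0 \<Longrightarrow> 3 - 2 * golden_ratio < x * golden_ratio - y"
proof -
  have "1 - golden_ratio < x * golden_ratio - y \<and> x * golden_ratio - y < 2 - golden_ratio \<and>
      (ds = [] \<or> last ds = 0 \<longrightarrow> 3 - 2 * golden_ratio < x * golden_ratio - y)"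
    using assms
  proof (induction ds arbitrary: x y rule: rev_induct)
    case Nil
    then show ?case using golden_ratio_bounds by simp
  next
    case (snoc d ds)
    obtain u v where uv: "read_digits ds = (u, v)" by force
    define e where "e = u * golden_ratio - v"
    have sp: "sparse_digits ds" "d = 0 \<or> d = 1 \<and> (ds = [] \<or> last ds = 0)"
      using snoc.prems sparse_digits_snoc by auto
    note IH = snoc.IH[OF sp(1) uv, folded e_def]
    have xy: "x = v + d" "y = u + v + 2 * d" using snoc.prems uv by auto
    have "u * (golden_ratio * golden_ratio) = u * (golden_ratio + 1)"
      by (simp only: golden_ratio_square)
    then have err: "x * golden_ratio - y = - ((golden_ratio - 1) * e) - (2 - golden_ratio) * d"
      by (simp add: xy e_def algebra_simps)
    have pos: "golden_ratio - 1 > 0" using golden_ratio_bounds by simp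
    have 1: "(golden_ratio - 1) * (1 - golden_ratio) < (golden_ratio - 1) * e"
      and 2: "(golden_ratio - 1) * e < (golden_ratio - 1) * (2 - golden_ratio)"
      and 3: "d = 1 \<Longrightarrow> (golden_ratio - 1) * (3 - 2 * golden_ratio) < (golden_ratio - 1) * e"
      using IH sp(2) pos by (auto intro: mult_strict_left_mono)
    \<comment> \<open>Digit 0 sends the endpoint \<open>2 - \<phi>\<close> to
      \<open>3 - 2 * \<phi>\<close> and \<open>1 - \<phi>\<close> to \<open>2 - \<phi>\<close>;
      digit 1 lowers the first image to \<open>1 - \<phi>\<close>.\<close>
    have "(golden_ratio - 1) * (1 - golden_ratio) = golden_ratio - 2"
      "(golden_ratio - 1) * (2 - golden_ratio) = 2 * golden_ratio - 3"
      "(golden_ratio - 1) * (3 - 2 * golden_ratio) = 3 * golden_ratio - 5"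
      using golden_ratio_square by (auto simp: algebra_simps)
    then show ?case using 1 2 3 sp(2) err golden_ratio_bounds by auto
  qed
  then show "1 - golden_ratio < x * golden_ratio - y" "x * golden_ratio - y < 2 - golden_ratio"
    "ds = [] \<or> last ds = 0 \<Longrightarrow> 3 - 2 * golden_ratio < x * golden_ratio - y" by auto
qed

text \<open>The two error bounds say \<open>y + 1 < (x + 1) * \<phi> < y + 2\<close>, which explains
  the \<open>m + 1\<close> in \<open>shift\<close>.\<close>

lemma snd_read_digits:
  assumes "sparse_digits ds"
  shows "snd (read_digits ds) = shift (fst (read_digits ds))"
proof -
  obtain x y where xy: "read_digits ds = (x, y)" by force
  have "shift x = y"
    using read_digits_error(1,2)[OF assms xy] by (intro shift_eqI) (auto simp: algebra_simps)
  then show ?thesis using xy by simp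
qed

text \<open>
  The equations for \<open>shift\<close> in \<open>step\<close> hold whenever \<open>d\<close> can follow the representations of
  \<open>m\<close> and \<open>k\<close>; they fail for \<open>d = 1\<close> after a digit \<open>1\<close>.
\<close>

lemma finite_state_fibonacci_automatic:
  fixes s :: "nat \<Rightarrow> 'q" and out :: "'q \<Rightarrow> 'd"
  assumes fin: "finite (range s)"
    and step: "\<And>d m k. d \<in> {0, 1} \<Longrightarrow> s m = s k \<Longrightarrow>
      shift (shift m + d) = shift m + m + 2 * d \<Longrightarrow> shift (shift k + d) = shift k + k + 2 * d \<Longrightarrow>
      s (shift m + d) = s (shift k + d)"
  shows "fibonacci_automatic (\<lambda>n. out (s n))"
proof -
  define P where "P d m \<longleftrightarrow> shift (shift m + d) = shift m + m + 2 * d" for d m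
  have "\<exists>h. \<forall>m. P d m \<longrightarrow> s (shift m + d) = h (s m)" if "d \<in> {0, 1}" for d
    using step[OF that] function_factors_left_gen[of "P d" s "\<lambda>m. s (shift m + d)"]
    unfolding P_def by blast
  then obtain h where h: "\<And>d m. d \<in> {0, 1} \<Longrightarrow> P d m \<Longrightarrow> s (shift m + d) = h d (s m)" by metis
  obtain c :: "'q \<Rightarrow> nat" where c: "inj_on c (range s)"
    using finite_imp_inj_to_nat_seg[OF fin] by blast
  define dec where "dec = inv_into (range s) c"
  have dec: "dec (c (s m)) = s m" for m
    unfolding dec_def using c by (simp add: inv_into_f_f)
  \<comment> \<open>Transitions that never arise may leave \<open>range s\<close>; they are
    redirected to the initial state.\<close>
  define \<delta> where "\<delta> q d = (if h d (dec q) \<in> range s then c (h d (dec q)) else c (s 0))" for q d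
  have fold: "foldl \<delta> (c (s 0)) ds = c (s (fst (read_digits ds)))" if "sparse_digits ds" for ds
    using that
  proof (induction ds rule: rev_induct)
    case (snoc d ds)
    define x where "x = fst (read_digits ds)"
    have sp: "sparse_digits ds" "d \<in> {0, 1}" using snoc.prems by (auto simp: sparse_digits_snoc)
    have x: "read_digits ds = (x, shift x)" using snd_read_digits[OF sp(1)] by (simp add: x_def prod_eq_iff)
    then have y: "read_digits (ds @ [d]) = (shift x + d, x + shift x + 2 * d)"
      by simp
    \<comment> \<open>The recursion and \<open>snd_read_digits\<close> give two expressions for the
      second component; equating them is \<open>P d x\<close>.\<close>
    then have "P d x" using snd_read_digits[OF snoc.prems] by (simp add: P_def)
    then have "h d (s x) = s (shift x + d)" using h sp(2) by metis
    then have "\<delta> (c (s x)) d = c (s (shift x + d))" by (simp add: \<delta>_def dec)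
    moreover have "foldl \<delta> (c (s 0)) ds = c (s x)" using snoc.IH[OF sp(1)] x by simp
    moreover have "fst (read_digits (ds @ [d])) = shift x + d" using y by simp
    ultimately show ?case by simp
  qed simp
  show ?thesis
    unfolding fibonacci_automatic_def
  proof (intro exI conjI allI)
    show "finite (c ` range s)" "c (s 0) \<in> c ` range s" using fin by auto
    show "\<forall>q\<in>c ` range s. \<forall>d\<in>{0, 1}. \<delta> q d \<in> c ` range s" by (auto simp: \<delta>_def)
    show "out (s n) = out (dec (foldl \<delta> (c (s 0)) (rep_F n)))" for n
      using fold[OF sparse_rep_F] by (simp add: fst_read_rep_F dec)
  qed
qed


section \<open>The automaton\<close>

text \<open>At 0 the difference would be 3, outside the allowed values; the formulas only evaluate
  \<open>gap\<close> at \<open>n + 1\<close>.\<close>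

definition gap :: "nat \<Rightarrow> nat" where
  "gap m = (if m = 0 then 0 else low m - shift m)"

lemma gap_le: "gap m \<le> 2"
  using low_le_shift[of m] by (cases "m = 0") (simp_all add: gap_def)

lemma low_eq_shift_gap: "m \<ge> 1 \<Longrightarrow> low m = shift m + gap m"
  using shift_le_low[of m] by (simp add: gap_def)

section \<open>Windows of five positions\<close>

definition agree :: "nat \<Rightarrow> nat \<Rightarrow> bool" where
  "agree m k \<longleftrightarrow> (\<forall>j\<le>4. is_low (m - j) \<longleftrightarrow> is_low (k - j))"

lemma agree_sym: "agree m k \<Longrightarrow> agree k m"
  by (simp add: agree_def)

text \<open>Of two neighbours from 4 on, one is a value of \<open>low\<close>, so two steps gain at
  least 3. Hence five positions at \<open>m\<close> control seven at \<open>low m\<close>, enough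
  for offsets \<open>gap m + j \<le> 2 + 4\<close>.\<close>

lemma low_ge_back_4:
  assumes "m \<ge> 8"
  shows "low (m - 4) + 6 \<le> low m"
proof -
  have two: "low k + 3 \<le> low (Suc (Suc k))" if "k \<ge> 4" for k
    using is_low_Suc_if_not_is_low[OF that] low_Suc[of k] low_Suc[of "Suc k"] by auto
  have "Suc (Suc (m - 4)) = m - 2" "Suc (Suc (m - 2)) = m" using assms by auto
  then show ?thesis using two[of "m - 4"] two[of "m - 2"] assms by simp
qed

context
  fixes m k :: nat
  assumes ge: "m \<ge> 8" "k \<ge> 8" and agree: "agree m k"
begin

lemma agree_low_diff: "j \<le> 4 \<Longrightarrow> low m + low (k - j) = low k + low (m - j)"
proof (induction j)
  case (Suc j)
  then have "m - j = Suc (m - Suc j)" "k - j = Suc (k - Suc j)" using ge by auto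
  moreover have "is_low (m - Suc j) \<longleftrightarrow> is_low (k - Suc j)"
    using agree Suc.prems by (auto simp: agree_def)
  ultimately have "low (m - j) + low (k - Suc j) = low (k - j) + low (m - Suc j)"
    using low_Suc[of "m - Suc j"] low_Suc[of "k - Suc j"] by simp
  then show ?case using Suc by simp
qed simp

text \<open>A value within 6 below \<open>low m\<close> is \<open>low (m - j)\<close> with
  \<open>j \<le> 4\<close>; equal differences carry it to \<open>low (k - j)\<close>.\<close>

lemma agree_is_low_imp:
  assumes "r \<le> 6" "is_low (low m - r)"
  shows "is_low (low k - r)"
proof -
  obtain i where i: "i \<ge> 1" "low i = low m - r" using assms unfolding is_low_def by blast
  have le: "low (m - 4) \<le> low i" "low i \<le> low m" using i assms low_ge_back_4[OF ge(1)] by auto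
  then have "i \<ge> m - 4" "i \<le> m" by simp_all
  define j where "j = m - i"
  have j: "j \<le> 4" "i = m - j" using \<open>i \<ge> m - 4\<close> \<open>i \<le> m\<close> by (auto simp: j_def)
  have "low m - r + r = low m" using low_ge[of m] ge assms by simp
  then have "low (k - j) + r = low k" using agree_low_diff[OF j(1)] i(2)[unfolded j(2)] by linarith
  then have "low k - r = low (k - j)" by linarith
  then show ?thesis using is_low_low[of "k - j"] ge j by simp
qed

end

lemma agree_is_low:
  "m \<ge> 8 \<Longrightarrow> k \<ge> 8 \<Longrightarrow> agree m k \<Longrightarrow> r \<le> 6 \<Longrightarrow> is_low (low m - r) \<longleftrightarrow> is_low (low k - r)"
  using agree_is_low_imp agree_sym by blast

text \<open>The increments of \<open>low\<close> just below \<open>low m\<close> and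
  \<open>low k\<close> coincide; sums replace truncated subtraction.\<close>

lemma agree_low_low_diff:
  assumes "m \<ge> 8" "k \<ge> 8" "agree m k"
  shows "r \<le> 6 \<Longrightarrow> low (low m) + low (low k - r) = low (low k) + low (low m - r)"
proof (induction r)
  case (Suc r)
  then have "low m - r = Suc (low m - Suc r)" "low k - r = Suc (low k - Suc r)"
    using low_ge[of m] low_ge[of k] assms Suc.prems by linarith+
  moreover have "is_low (low m - Suc r) \<longleftrightarrow> is_low (low k - Suc r)"
    using agree_is_low assms Suc.prems by blast
  ultimately have "low (low m - r) + low (low k - Suc r) = low (low k - r) + low (low m - Suc r)"
    using low_Suc[of "low m - Suc r"] low_Suc[of "low k - Suc r"] by simp
  then show ?case using Suc by simp
qed simp

text \<open>Below \<open>8\<close> the first component makes \<open>state\<close> injective.\<close>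

definition state :: "nat \<Rightarrow> nat \<times> nat \<times> bool list" where
  "state m = (min m 8, gap m, map (\<lambda>j. is_low (m - j)) [0..<5])"

lemma finite_range_state: "finite (range state)"
proof (rule finite_subset)
  show "range state \<subseteq> {..8} \<times> {..2} \<times> {bs. set bs \<subseteq> UNIV \<and> length bs = 5}"
    unfolding state_def using gap_le by (intro image_subsetI) simp
  show "finite ({..8::nat} \<times> {..2::nat} \<times> {bs :: bool list. set bs \<subseteq> UNIV \<and> length bs = 5})"
    by (intro finite_cartesian_product finite_lists_length_eq) auto
qed

lemma agree_iff: "map (\<lambda>j. is_low (m - j)) [0..<5] = map (\<lambda>j. is_low (k - j)) [0..<5] \<longleftrightarrow> agree m k"
  by (auto simp: agree_def)

lemma low_shift_add:
  assumes "m \<ge> 8" "d \<in> {0, 1}"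
  shows "low (shift m + d) = (if d \<le> gap m then low (low m - (gap m - d)) else low (low m) + 2)"
proof (cases "d \<le> gap m")
  case True
  then have "shift m + d = low m - (gap m - d)" using low_eq_shift_gap[of m] assms by simp
  then show ?thesis using True by simp
next
  case False
  then have "shift m + d = Suc (low m)" using low_eq_shift_gap[of m] assms by auto
  then show ?thesis using False low_Suc[of "low m"] is_low_low[of m] assms by simp
qed

text \<open>Both \<open>low (shift m + d)\<close> and \<open>shift (shift m + d)\<close> equal
  \<open>shift m + m\<close> plus a term fixed by \<open>d\<close>, the gap and the window, so the
  new gap depends on the state alone.\<close>

lemma state_step:
  assumes d: "d \<in> {0, 1}" and eq: "state m = state k"
    and sm: "shift (shift m + d) = shift m + m + 2 * d"
    and sk: "shift (shift k + d) = shift k + k + 2 * d"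
  shows "state (shift m + d) = state (shift k + d)"
proof (cases "m < 8")
  case True
  then have "m = k" using eq by (auto simp: state_def min_def split: if_splits)
  then show ?thesis by simp
next
  case False
  then have ge: "m \<ge> 8" "k \<ge> 8" using eq by (auto simp: state_def min_def split: if_splits)
  have g: "gap m = gap k" and ag: "agree m k" using eq agree_iff by (simp_all add: state_def)
  have ge': "shift m + d \<ge> 8" "shift k + d \<ge> 8" using shift_ge[of m] shift_ge[of k] ge by auto
  have r: "gap k - d \<le> 6" using gap_le[of k] by linarith
  have "low (low m) + low (shift k + d) = low (low k) + low (shift m + d)"
    unfolding low_shift_add[OF ge(1) d] low_shift_add[OF ge(2) d] g
    using agree_low_low_diff[OF ge ag r] by (cases "d \<le> gap k") simp_all
  moreover have "low (low m) = shift m + gap m + m + 2" "low (low k) = shift k + gap m + k + 2"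
    using low_low[of m] low_low[of k] low_eq_shift_gap[of m] low_eq_shift_gap[of k] ge g by auto
  ultimately have gap: "gap (shift m + d) = gap (shift k + d)"
    using low_eq_shift_gap[of "shift m + d"] low_eq_shift_gap[of "shift k + d"] ge' sm sk by simp
  have "agree (shift m + d) (shift k + d)"
    unfolding agree_def
  proof (intro allI impI)
    fix j :: nat assume j: "j \<le> 4"
    show "is_low (shift m + d - j) \<longleftrightarrow> is_low (shift k + d - j)"
    \<comment> \<open>Only \<open>d = 1\<close>, \<open>gap m = 0\<close>, \<open>j = 0\<close>
      leads to the right of \<open>low m\<close>; there bit 0 of the old window decides.\<close>
    proof (cases "d \<le> gap m + j")
      case True
      then have "shift m + d - j = low m - (gap m + j - d)" "shift k + d - j = low k - (gap m + j - d)"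
        using low_eq_shift_gap[of m] low_eq_shift_gap[of k] ge g by auto
      then show ?thesis using agree_is_low[OF ge ag, of "gap m + j - d"] j gap_le[of m] by simp
    next
      case False
      then have "shift m + d - j = Suc (low m)" "shift k + d - j = Suc (low k)"
        using low_eq_shift_gap[of m] low_eq_shift_gap[of k] ge g d by auto
      then show ?thesis using ag[unfolded agree_def, rule_format, of 0] by (simp add: is_low_Suc_low)
    qed
  qed
  then show ?thesis using gap ge' agree_iff by (simp add: state_def)
qed

lemma fibonacci_automatic_gap: "fibonacci_automatic gap"
proof -
  have "fibonacci_automatic (\<lambda>n. fst (snd (state n)))"
    by (rule finite_state_fibonacci_automatic[OF finite_range_state]) (rule state_step)
  then show ?thesis by (simp add: state_def)
qed

theorem theorem13:
  shows "\<exists>a b :: nat \<Rightarrow> nat. nonterminal_P_listing 3 a b \<and>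
    (\<exists>g\<^sub>3 :: nat \<Rightarrow> nat. range g\<^sub>3 \<subseteq> {0, 1, 2} \<and> fibonacci_automatic g\<^sub>3 \<and>
      (\<forall>n. int (a n) = \<lfloor>real (n + 2) * golden_ratio\<rfloor> + int (g\<^sub>3 (n + 1)) - 1 \<and>
           int (b n) = \<lfloor>real (n + 2) * golden_ratio\<^sup>2\<rfloor> + int (g\<^sub>3 (n + 1)) + 1))"
proof (intro exI conjI allI)
  show "nonterminal_P_listing 3 (\<lambda>n. low (n + 1)) (\<lambda>n. high (n + 1))"
    by (rule nonterminal_P_listing_low_high)
  show "range gap \<subseteq> {0, 1, 2}"
  proof
    fix x assume "x \<in> range gap"
    then have "x \<le> 2" using gap_le by blast
    then show "x \<in> {0, 1, 2}" by auto
  qed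
  show "fibonacci_automatic gap" by (rule fibonacci_automatic_gap)
  fix n
  have fl: "\<lfloor>real (n + 2) * golden_ratio\<rfloor> = int (shift (n + 1)) + 1"
    using floor_eq_shift[of "n + 1"] by (simp add: add.commute)
  show low: "int (low (n + 1)) = \<lfloor>real (n + 2) * golden_ratio\<rfloor> + int (gap (n + 1)) - 1"
    using fl low_eq_shift_gap[of "n + 1"] by simp
  \<comment> \<open>By \<open>\<phi>\<^sup>2 = \<phi> + 1\<close> the floors differ by
    \<open>n + 2\<close>; the constants \<open>1\<close> and \<open>- 1\<close> supply the other 2
    of \<open>high - low = n + 4\<close>.\<close>
  have "real (n + 2) * golden_ratio\<^sup>2 = real (n + 2) * golden_ratio + of_int (int (n + 2))"
    using golden_ratio_square by (simp add: power2_eq_square algebra_simps)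
  then have "\<lfloor>real (n + 2) * golden_ratio\<^sup>2\<rfloor> = \<lfloor>real (n + 2) * golden_ratio\<rfloor> + int (n + 2)"
    by (simp only: floor_add_int)
  then show "int (high (n + 1)) = \<lfloor>real (n + 2) * golden_ratio\<^sup>2\<rfloor> + int (gap (n + 1)) + 1"
    using low by (simp add: high_def)
qed

end
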